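(* Fix the per-group sample size $n$, and assume $P(T_n\in C)>0$ under the marginal law. Then for almost all sequences $\theta_1,\theta_2,\ldots$ (i.e. with probability one when the $\theta_i$ are i.i.d. from $G$), as $m\to\infty$, $$\frac{\sum_{i=1}^m I_{\{T_{ni}\in C,\ \theta_i\le\theta_0\}}}{\big(\sum_{i=1}^m I_{\{T_{ni}\in C\}}\big)\vee 1}\ \longrightarrow\ \delta_n$$ almost surely under the conditional law of the data given $\theta_1,\theta_2,\ldots$, and moreover $$FDR(\theta_1,\ldots,\theta_m)\longrightarrow \delta_n .$$ That is, the frequentist false discovery rate converges to the Bayesian false discovery rate $\delta_n$ almost surely under the prior $G$.
   Context: Let $f(x,\theta)$ be a family of densities indexed by $\theta$ in an interval $\Omega\subseteq\mathbb R$, let $\theta_0\in\Omega$, and consider testing $H_0:\theta\le\theta_0$ against $H_1:\theta>\theta_0$ with the test that rejects $H_0$ when $T_n\in C$, where $T_n$ is a statistic (a measurable function of a sample of size $n$) and $C$ is a rejection region. There is an infinite sequence of groups of samples: $\theta_1,\theta_2,\ldots$ are i.i.d. with CDF $G$ on $\Omega$ (which need not have a density), and, given $\theta_1,\theta_2,\ldots$, the groups $(X_{i1},\ldots,X_{in})$, $i=1,2,\ldots$, are independent, with $X_{i1},\ldots,X_{in}$ i.i.d. with density $f(x,\theta_i)$. $T_{ni}$ denotes the test statistic $T_n$ computed from $X_{i1},\ldots,X_{in}$. The Bayesian false discovery rate is $$\delta_n=P(\theta\le\theta_0\mid T_n\in C)=\frac{P(\theta\le\theta_0,\,T_n\in C)}{P(T_n\in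 C)},$$ where $\theta\sim G$ and, given $\theta$, $T_n$ is computed from an i.i.d. sample of size $n$ from $f(\cdot,\theta)$. The frequentist false discovery rate is $$FDR(\theta_1,\ldots,\theta_m)=E_{\theta_1,\ldots,\theta_m}\left\{\frac{\sum_{i=1}^m I_{\{T_{ni}\in C,\ \theta_i\le\theta_0\}}}{\big(\sum_{i=1}^m I_{\{T_{ni}\in C\}}\big)\vee 1}\right\},$$ where $E_{\theta_1,\ldots,\theta_m}$ is the conditional expectation given $\theta_1,\ldots,\theta_m$ and $a\vee b=\max(a,b)$. *)

theory Defs
  imports "HOL-Probability.Probability"
begin

definition is_cdf :: "(real \<Rightarrow> real) \<Rightarrow> bool" where
  "is_cdf G \<longleftrightarrow> mono G \<and> (\<forall>a. continuous (at_right a) G) \<and>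
     (G \<longlongrightarrow> 0) at_bot \<and> (G \<longlongrightarrow> 1) at_top"

text \<open>The law on \<open>\<Omega>\<close> with CDF \<open>G\<close>. Its underlying space is \<open>\<Omega>\<close> itself, so that nothing is
  ever required of \<open>f x \<theta>\<close> for \<open>\<theta>\<close> outside \<open>\<Omega>\<close>. It is a probability measure when \<open>G\<close> is a CDF
  giving mass one to \<open>\<Omega>\<close>.\<close>

definition prior :: "real set \<Rightarrow> (real \<Rightarrow> real) \<Rightarrow> real measure" where
  "prior \<Omega> G = restrict_space (interval_measure G) \<Omega>"

text \<open>\<open>f\<close> is a family of densities with respect to a dominating measure \<open>\<mu>\<close>; joint measurability
  in \<open>(x, \<theta>)\<close> is what makes probabilities under a random \<open>\<theta>\<close> meaningful.\<close>

definition density_family :: "'a measure \<Rightarrow> real set \<Rightarrow> ('a \<Rightarrow> real \<Rightarrow> real) \<Rightarrow> bool" where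
  "density_family \<mu> \<Omega> f \<longleftrightarrow>
     (\<lambda>(x, \<theta>). f x \<theta>) \<in> borel_measurable (\<mu> \<Otimes>\<^sub>M restrict_space borel \<Omega>) \<and>
     (\<forall>\<theta>\<in>\<Omega>. (\<forall>x\<in>space \<mu>. 0 \<le> f x \<theta>) \<and> (\<integral>\<^sup>+x. ennreal (f x \<theta>) \<partial>\<mu>) = 1)"

definition sample_law :: "'a measure \<Rightarrow> ('a \<Rightarrow> real \<Rightarrow> real) \<Rightarrow> nat \<Rightarrow> real \<Rightarrow> (nat \<Rightarrow> 'a) measure" where
  "sample_law \<mu> f n \<theta> = (\<Pi>\<^sub>M j\<in>{..<n}. density \<mu> (\<lambda>x. ennreal (f x \<theta>)))"

text \<open>Joint law of \<open>(\<theta>, (X\<^sub>1, \<dots>, X\<^sub>n))\<close>, where \<open>\<theta>\<close> is drawn from \<open>G\<close> and then the sample is drawn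
  given \<open>\<theta>\<close>.\<close>

definition joint_law ::
    "'a measure \<Rightarrow> ('a \<Rightarrow> real \<Rightarrow> real) \<Rightarrow> real set \<Rightarrow> (real \<Rightarrow> real) \<Rightarrow> nat \<Rightarrow> (real \<times> (nat \<Rightarrow> 'a)) measure"
  where
  "joint_law \<mu> f \<Omega> G n =
     prior \<Omega> G \<bind> (\<lambda>\<theta>. distr (sample_law \<mu> f n \<theta>) (prior \<Omega> G \<Otimes>\<^sub>M (\<Pi>\<^sub>M j\<in>{..<n}. \<mu>)) (\<lambda>x. (\<theta>, x)))"

definition bayes_fdr ::
    "'a measure \<Rightarrow> ('a \<Rightarrow> real \<Rightarrow> real) \<Rightarrow> real set \<Rightarrow> (real \<Rightarrow> real) \<Rightarrow> nat \<Rightarrow>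
     ((nat \<Rightarrow> 'a) \<Rightarrow> 'b) \<Rightarrow> 'b set \<Rightarrow> real \<Rightarrow> real" where
  "bayes_fdr \<mu> f \<Omega> G n T C \<theta>0 =
     \<P>(\<omega> in joint_law \<mu> f \<Omega> G n. fst \<omega> \<le> \<theta>0 \<bar> T (snd \<omega>) \<in> C)"

text \<open>Conditional law, given the parameter sequence \<open>\<theta>\<close>, of the groups with index in \<open>I\<close>.
  Groups are numbered from \<open>0\<close>; a data point \<open>x\<close> has group \<open>i\<close> equal to \<open>x i\<close>.\<close>

definition data_law ::
    "'a measure \<Rightarrow> ('a \<Rightarrow> real \<Rightarrow> real) \<Rightarrow> nat \<Rightarrow> nat set \<Rightarrow> (nat \<Rightarrow> real) \<Rightarrow> (nat \<Rightarrow> nat \<Rightarrow> 'a) measure"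
  where
  "data_law \<mu> f n I \<theta> = (\<Pi>\<^sub>M i\<in>I. sample_law \<mu> f n (\<theta> i))"

definition fdp ::
    "((nat \<Rightarrow> 'a) \<Rightarrow> 'b) \<Rightarrow> 'b set \<Rightarrow> real \<Rightarrow> nat \<Rightarrow> (nat \<Rightarrow> real) \<Rightarrow> (nat \<Rightarrow> nat \<Rightarrow> 'a) \<Rightarrow> real" where
  "fdp T C \<theta>0 m \<theta> x =
     (\<Sum>i<m. of_bool (T (x i) \<in> C \<and> \<theta> i \<le> \<theta>0)) / max (\<Sum>i<m. of_bool (T (x i) \<in> C)) 1"

definition FDR ::
    "'a measure \<Rightarrow> ('a \<Rightarrow> real \<Rightarrow> real) \<Rightarrow> nat \<Rightarrow> ((nat \<Rightarrow> 'a) \<Rightarrow> 'b) \<Rightarrow> 'b set \<Rightarrow> real \<Rightarrow>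
     nat \<Rightarrow> (nat \<Rightarrow> real) \<Rightarrow> real" where
  "FDR \<mu> f n T C \<theta>0 m \<theta> = (\<integral>x. fdp T C \<theta>0 m \<theta> x \<partial>data_law \<mu> f n {..<m} \<theta>)"

end

theory Submission
  imports Defs
begin

text \<open>
  Write \<open>p \<theta>\<close> for the probability of \<open>T \<in> C\<close> when the sample is drawn from the density \<open>\<lambda>x. f x \<theta>\<close>. The false
  discovery proportion is a quotient of two averages over the groups, and each average converges
  by two successive applications of one strong law.

  For a fixed parameter sequence the indicators of \<open>T (x i) \<in> C\<close> are independent but not
  identically distributed, since the success probability \<open>p (\<theta> i)\<close> changes from group to group.
  The strong law \<open>bounded_strong_law\<close> for independent variables with values in \<open>[0, 1]\<close> shows that
  their average differs from the average of the \<open>p (\<theta> i)\<close> by a null sequence, almost surely; likewise with the factor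
  \<open>of_bool (\<theta> i \<le> \<theta>0)\<close>. Now let the \<open>\<theta> i\<close> be drawn from the prior: the same law says that for almost
  every parameter sequence the averages of \<open>p (\<theta> i)\<close> and of \<open>of_bool (\<theta> i \<le> \<theta>0) * p (\<theta> i)\<close> tend
  to the prior means. By \<open>measure_joint_law\<close> these means are the denominator and the numerator of the
  Bayesian rate, and the denominator is positive, so the quotients converge
  (\<open>tendsto_ratio_of_averages\<close>).

  The frequentist rate is the expectation of the false discovery proportion, which lies in \<open>[0, 1]\<close>,
  so its convergence follows from almost sure convergence by dominated convergence
  (\<open>fdr_tendsto_given_parameters\<close>). All exceptional sets at the level of the parameters come from
  the second application of the strong law.
\<close>

section \<open>A strong law for bounded independent variables\<close>

text \<open>Hoeffding's inequality bounds the probability of a deviation of the average of at least \<open>\<epsilon>\<close> by a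
  geometric sequence in \<open>m\<close>, so Borel--Cantelli applies directly; as Hoeffding's bound depends only
  on the ranges, the variables may have different laws.\<close>

lemma (in prob_space) bounded_strong_law:
  fixes X :: "nat \<Rightarrow> 'a \<Rightarrow> real"
  assumes indep: "indep_vars (\<lambda>_. borel) X UNIV"
    and bounded: "\<And>i x. x \<in> space M \<Longrightarrow> X i x \<in> {0..1}"
  shows "AE x in M. (\<lambda>m. (\<Sum>i<m. X i x) / m - (\<Sum>i<m. expectation (X i)) / m) \<longlonglongrightarrow> 0"
proof -
  have [measurable]: "X i \<in> borel_measurable M" for i
    using indep unfolding indep_vars_def by blast
  define D where "D m x = \<bar>(\<Sum>i<m. X i x) - (\<Sum>i<m. expectation (X i))\<bar>" for m :: nat and x
  have [measurable]: "D m \<in> borel_measurable M" for m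
    unfolding D_def by measurable
  \<comment> \<open>At \<open>m = 0\<close>, where Hoeffding's inequality does not apply, the bound is the trivial \<open>2\<close>.\<close>
  have tail: "prob {x\<in>space M. D m x \<ge> m * \<epsilon>} \<le> 2 * exp (-2 * \<epsilon>\<^sup>2) ^ m"
    if "\<epsilon> > 0" for m :: nat and \<epsilon> :: real
  proof (cases "m = 0")
    case True
    then show ?thesis
      by (auto intro: order_trans[OF prob_le_1])
  next
    case False
    interpret Hoeffding_ineq M "{..<m}" X "\<lambda>_. 0" "\<lambda>_. 1" "\<Sum>i<m. expectation (X i)"
    proof unfold_locales
      show "indep_vars (\<lambda>_. borel) X {..<m}"
        using indep by (rule indep_vars_subset) auto
      show "AE x in M. X i x \<in> {0..1}" for i
        using bounded by auto
    qed auto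
    have "prob {x\<in>space M. D m x \<ge> m * \<epsilon>} \<le> 2 * exp (-2 * (m * \<epsilon>)\<^sup>2 / m)"
      using Hoeffding_ineq_abs_ge[of "m * \<epsilon>"] False that unfolding D_def by simp
    also have "-2 * (m * \<epsilon>)\<^sup>2 / m = m * (-2 * \<epsilon>\<^sup>2)"
      using False by (simp add: power2_eq_square)
    finally show ?thesis
      by (simp only: exp_of_nat_mult)
  qed
  have ev: "AE x in M. \<forall>\<^sub>F m in sequentially. x \<in> space M - {x\<in>space M. D m x \<ge> m * \<epsilon>}"
    if "\<epsilon> > 0" for \<epsilon> :: real
  proof (rule borel_cantelli_AE1)
    have "summable (\<lambda>m. 2 * exp (-2 * \<epsilon>\<^sup>2) ^ m)"
      using that by (intro summable_mult summable_geometric) auto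
    then show "summable (\<lambda>m. prob {x\<in>space M. D m x \<ge> m * \<epsilon>})"
      by (rule summable_comparison_test') (use tail[OF that] in auto)
  qed (auto simp: emeasure_eq_measure)
  have "AE x in M. \<forall>k::nat. \<forall>\<^sub>F m in sequentially.
      x \<in> space M - {x\<in>space M. D m x \<ge> m * (1 / Suc k)}"
    unfolding AE_all_countable by (intro allI ev) simp
  then show ?thesis
  proof eventually_elim
    case (elim x)
    show ?case
    proof (rule LIMSEQ_I, goal_cases)
      case (1 r)
      then obtain k where k: "1 / Suc k < r"
        using nat_approx_posE by (metis)
      have "\<forall>\<^sub>F m in sequentially. norm ((\<Sum>i<m. X i x) / m - (\<Sum>i<m. expectation (X i)) / m - 0) < r"
        using elim[rule_format, of k] eventually_gt_at_top[of 0]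
      proof eventually_elim
        case (elim m)
        then have "D m x < m * (1 / Suc k)" by auto
        also have "\<dots> \<le> m * r" using k by (intro mult_left_mono) auto
        finally have "D m x / m < r" using elim(2) by (simp add: field_simps)
        then show ?case
          by (simp add: D_def diff_divide_distrib[symmetric])
      qed
      then show ?case by (simp add: eventually_sequentially)
    qed
  qed
qed

lemma bounded_strong_law_PiM:
  fixes M :: "nat \<Rightarrow> 'a measure" and g :: "nat \<Rightarrow> 'a \<Rightarrow> real"
  assumes M: "\<And>i. prob_space (M i)"
    and g: "\<And>i. g i \<in> borel_measurable (M i)"
    and bounded: "\<And>i x. x \<in> space (M i) \<Longrightarrow> g i x \<in> {0..1}"
  shows "AE \<omega> in PiM UNIV M.
    (\<lambda>m. (\<Sum>i<m. g i (\<omega> i)) / m - (\<Sum>i<m. \<integral>x. g i x \<partial>M i) / m) \<longlonglongrightarrow> 0"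
proof -
  interpret P: product_prob_space M UNIV
    by (intro product_prob_spaceI M)
  note [measurable] = g
  have "P.P.indep_vars M (\<lambda>i \<omega>. \<omega> i) UNIV"
    by (subst P.P.indep_vars_iff_distr_eq_PiM') (simp_all add: P.PiM_component restrict_UNIV)
  then have "P.P.indep_vars (\<lambda>_. borel) (\<lambda>i \<omega>. g i (\<omega> i)) UNIV"
    by (rule P.P.indep_vars_compose2) auto
  then have "AE \<omega> in PiM UNIV M.
    (\<lambda>m. (\<Sum>i<m. g i (\<omega> i)) / m - (\<Sum>i<m. P.P.expectation (\<lambda>\<omega>. g i (\<omega> i))) / m) \<longlonglongrightarrow> 0"
    by (rule P.P.bounded_strong_law) (use bounded in \<open>auto simp: space_PiM PiE_def Pi_def\<close>)
  moreover have "P.P.expectation (\<lambda>\<omega>. g i (\<omega> i)) = (\<integral>x. g i x \<partial>M i)" for i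
    using integral_distr[of "\<lambda>\<omega>. \<omega> i" "PiM UNIV M" "M i" "g i"] g
    by (simp add: P.PiM_component)
  ultimately show ?thesis by simp
qed

section \<open>Quotients of averages\<close>

text \<open>Since \<open>t m\<close> grows like \<open>b * m\<close>, the maximum with \<open>1\<close> is eventually irrelevant.\<close>

lemma tendsto_ratio_of_averages:
  fixes s t :: "nat \<Rightarrow> real"
  assumes s: "(\<lambda>m. s m / m) \<longlonglongrightarrow> a" and t: "(\<lambda>m. t m / m) \<longlonglongrightarrow> b" and b: "b > 0"
  shows "(\<lambda>m. s m / max (t m) 1) \<longlonglongrightarrow> a / b"
proof (rule Lim_transform_eventually)
  show "(\<lambda>m. (s m / m) / (t m / m)) \<longlonglongrightarrow> a / b"
    using assms by (intro tendsto_divide) auto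
  have "\<forall>\<^sub>F m in sequentially. t m / m > b / 2"
    using t b by (intro order_tendstoD(1)[OF t]) auto
  moreover have "\<forall>\<^sub>F m in sequentially. real m > 2 / b"
    by (rule filterlim_at_top_dense[THEN iffD1, rule_format, OF filterlim_real_sequentially])
  ultimately show "\<forall>\<^sub>F m in sequentially. (s m / m) / (t m / m) = s m / max (t m) 1"
  proof eventually_elim
    case (elim m)
    have m: "real m > 0" using elim(2) b by (meson divide_pos_pos less_trans zero_less_numeral)
    have "1 < real m * (b / 2)" using elim(2) b by (simp add: field_simps)
    also have "\<dots> < t m" using elim(1) m by (simp add: field_simps)
    finally show ?case using m by simp
  qed
qed

section \<open>The sample law as a Markov kernel\<close>

lemma prob_space_density_family:
  assumes "density_family \<mu> \<Omega> f" "\<theta> \<in> \<Omega>"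
  shows "prob_space (density \<mu> (\<lambda>x. ennreal (f x \<theta>)))"
proof (rule prob_spaceI)
  have [measurable]: "(\<lambda>(x, \<theta>). f x \<theta>) \<in> borel_measurable (\<mu> \<Otimes>\<^sub>M restrict_space borel \<Omega>)"
    using assms by (simp add: density_family_def)
  have "(\<lambda>x. (x, \<theta>)) \<in> \<mu> \<rightarrow>\<^sub>M \<mu> \<Otimes>\<^sub>M restrict_space borel \<Omega>"
    using assms(2) by (intro measurable_Pair) (auto simp: space_restrict_space)
  from measurable_compose[OF this, of "\<lambda>(x, \<theta>). f x \<theta>" borel]
  have [measurable]: "(\<lambda>x. f x \<theta>) \<in> borel_measurable \<mu>" by simp
  show "emeasure (density \<mu> (\<lambda>x. ennreal (f x \<theta>))) (space (density \<mu> (\<lambda>x. ennreal (f x \<theta>)))) = 1"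
    using assms by (simp add: emeasure_density density_family_def cong: nn_integral_cong)
qed

text \<open>Measurability in \<open>\<theta>\<close> needs to be checked only on boxes, where the probability is a product of
  integrals of \<open>f x \<theta>\<close> over \<open>x\<close>; these are measurable in \<open>\<theta>\<close> by Tonelli, which is where
  \<open>\<sigma>\<close>-finiteness of \<open>\<mu>\<close> enters.\<close>

lemma measurable_sample_law:
  assumes \<mu>: "sigma_finite_measure \<mu>" and f: "density_family \<mu> \<Omega> f"
  shows "sample_law \<mu> f n \<in> restrict_space borel \<Omega> \<rightarrow>\<^sub>M prob_algebra (\<Pi>\<^sub>M j\<in>{..<n}. \<mu>)"
proof -
  let ?D = "\<lambda>\<theta>. density \<mu> (\<lambda>x. ennreal (f x \<theta>))"
  interpret sigma_finite_measure \<mu> by fact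
  have fm [measurable]: "(\<lambda>(x, \<theta>). f x \<theta>) \<in> borel_measurable (\<mu> \<Otimes>\<^sub>M restrict_space borel \<Omega>)"
    using f by (simp add: density_family_def)
  have [measurable]: "(\<lambda>(\<theta>, x). f x \<theta>) \<in> borel_measurable (restrict_space borel \<Omega> \<Otimes>\<^sub>M \<mu>)"
    using measurable_compose[OF measurable_pair_swap' fm] by (simp add: case_prod_unfold)
  have D [measurable]: "(\<lambda>\<theta>. emeasure (?D \<theta>) A) \<in> borel_measurable (restrict_space borel \<Omega>)"
    if A [measurable]: "A \<in> sets \<mu>" for A
  proof -
    have "(\<lambda>\<theta>. \<integral>\<^sup>+x. ennreal (f x \<theta>) * indicator A x \<partial>\<mu>) \<in> borel_measurable (restrict_space borel \<Omega>)"
      by measurable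
    also have "?this \<longleftrightarrow> ?thesis"
    proof (rule measurable_cong)
      fix \<theta> assume "\<theta> \<in> space (restrict_space borel \<Omega>)"
      then have "(\<lambda>x. f x \<theta>) \<in> borel_measurable \<mu>" by measurable
      then show "(\<integral>\<^sup>+x. ennreal (f x \<theta>) * indicator A x \<partial>\<mu>) = emeasure (?D \<theta>) A"
        by (simp add: emeasure_density)
    qed
    finally show ?thesis .
  qed
  show ?thesis
  proof (rule measurable_prob_algebra_generated[OF sets_PiM Int_stable_prod_algebra prod_algebra_sets_into_space])
    fix \<theta> assume "\<theta> \<in> space (restrict_space borel \<Omega>)"
    then show "prob_space (sample_law \<mu> f n \<theta>)"
      unfolding sample_law_def
      by (intro prob_space_PiM prob_space_density_family[OF f]) (simp add: space_restrict_space)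
    show "sets (sample_law \<mu> f n \<theta>) = sets (\<Pi>\<^sub>M j\<in>{..<n}. \<mu>)"
      unfolding sample_law_def by (intro sets_PiM_cong) auto
  next
    fix A assume "A \<in> prod_algebra {..<n} (\<lambda>_. \<mu>)"
    then obtain E where A: "A = (\<Pi>\<^sub>E j\<in>{..<n}. E j)" and E: "\<And>j. j < n \<Longrightarrow> E j \<in> sets \<mu>"
      by (auto simp: prod_algebra_eq_finite)
    have "(\<lambda>\<theta>. \<Prod>j<n. emeasure (?D \<theta>) (E j)) \<in> borel_measurable (restrict_space borel \<Omega>)"
      using E by measurable
    also have "?this \<longleftrightarrow> (\<lambda>\<theta>. emeasure (sample_law \<mu> f n \<theta>) A) \<in> borel_measurable (restrict_space borel \<Omega>)"
    proof (rule measurable_cong)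
      fix \<theta> assume "\<theta> \<in> space (restrict_space borel \<Omega>)"
      then interpret prob_space "?D \<theta>"
        by (intro prob_space_density_family[OF f]) (simp add: space_restrict_space)
      interpret finite_product_sigma_finite "\<lambda>_. ?D \<theta>" "{..<n}" by unfold_locales auto
      show "(\<Prod>j<n. emeasure (?D \<theta>) (E j)) = emeasure (sample_law \<mu> f n \<theta>) A"
        unfolding sample_law_def A using E by (subst emeasure_PiM) auto
    qed
    finally show "(\<lambda>\<theta>. emeasure (sample_law \<mu> f n \<theta>) A) \<in> borel_measurable (restrict_space borel \<Omega>)" .
  qed
qed

text \<open>A monadic bind carries no information unless its kernel is measurable, so the kernel property
  is what allows probabilities under \<open>joint_law\<close> to be computed by conditioning on the parameter.\<close>

lemma measure_joint_law:
  assumes P: "prob_space (prior \<Omega> G)"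
    and K: "sample_law \<mu> f n \<in> prior \<Omega> G \<rightarrow>\<^sub>M prob_algebra (\<Pi>\<^sub>M j\<in>{..<n}. \<mu>)"
    and A: "A \<in> sets (prior \<Omega> G \<Otimes>\<^sub>M (\<Pi>\<^sub>M j\<in>{..<n}. \<mu>))"
  shows "measure (joint_law \<mu> f \<Omega> G n) A =
    (\<integral>\<theta>. measure (sample_law \<mu> f n \<theta>) (Pair \<theta> -` A) \<partial>prior \<Omega> G)"
proof -
  let ?P = "prior \<Omega> G" and ?S = "\<Pi>\<^sub>M j\<in>{..<n}. \<mu>"
  let ?K = "\<lambda>\<theta>. distr (sample_law \<mu> f n \<theta>) (?P \<Otimes>\<^sub>M ?S) (Pair \<theta>)"
  interpret P: prob_space ?P by fact
  have Kmeas: "?K \<in> ?P \<rightarrow>\<^sub>M subprob_algebra (?P \<Otimes>\<^sub>M ?S)"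
    by (rule measurable_distr2[OF _ measurable_prob_algebraD[OF K]]) simp
  have eq: "emeasure (?K \<theta>) A = ennreal (measure (sample_law \<mu> f n \<theta>) (Pair \<theta> -` A))"
    if "\<theta> \<in> space ?P" for \<theta>
  proof -
    have sl: "prob_space (sample_law \<mu> f n \<theta>)" "sets (sample_law \<mu> f n \<theta>) = sets ?S"
      using measurable_space[OF K that] by (auto simp: space_prob_algebra)
    have sp: "space (sample_law \<mu> f n \<theta>) = space ?S" using sl(2) by (rule sets_eq_imp_space_eq)
    have "Pair \<theta> -` A \<inter> space ?S = Pair \<theta> -` A"
      using sets.sets_into_space[OF A] by (auto simp: space_pair_measure)
    moreover have "Pair \<theta> \<in> sample_law \<mu> f n \<theta> \<rightarrow>\<^sub>M ?P \<Otimes>\<^sub>M ?S"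
      using that by (simp cong: measurable_cong_sets add: measurable_cong_sets[OF sl(2) refl])
    ultimately show ?thesis
      using A sl(1) by (simp add: emeasure_distr sp finite_measure.emeasure_eq_measure prob_space_def)
  qed
  have meas: "(\<lambda>\<theta>. measure (sample_law \<mu> f n \<theta>) (Pair \<theta> -` A)) \<in> borel_measurable ?P"
  proof -
    have "(\<lambda>\<theta>. measure (?K \<theta>) A) \<in> borel_measurable ?P"
      using measurable_compose[OF Kmeas measurable_measure_subprob_algebra[OF A]] .
    also have "?this \<longleftrightarrow> ?thesis"
      using eq by (intro measurable_cong) (simp add: measure_def[of "?K _"])
    finally show ?thesis .
  qed
  have "emeasure (joint_law \<mu> f \<Omega> G n) A = (\<integral>\<^sup>+\<theta>. emeasure (?K \<theta>) A \<partial>?P)"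
    unfolding joint_law_def using P.not_empty Kmeas A by (intro emeasure_bind) auto
  also have "\<dots> = (\<integral>\<^sup>+\<theta>. ennreal (measure (sample_law \<mu> f n \<theta>) (Pair \<theta> -` A)) \<partial>?P)"
    using eq by (rule nn_integral_cong)
  finally show ?thesis
    unfolding measure_def[of "joint_law _ _ _ _ _"] using meas by (simp add: integral_eq_nn_integral)
qed

section \<open>False discovery rates for a given parameter sequence\<close>

text \<open>No prior is involved: the groups are independent with different laws, and a parameter sequence
  matters only through the limits of two averages of rejection probabilities.\<close>

lemma fdr_tendsto_given_parameters:
  fixes \<theta> :: "nat \<Rightarrow> real"
  assumes law: "\<And>i. sample_law \<mu> f n (\<theta> i) \<in> space (prob_algebra (\<Pi>\<^sub>M j\<in>{..<n}. \<mu>))"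
    and T: "T \<in> measurable (\<Pi>\<^sub>M j\<in>{..<n}. \<mu>) N" and C: "C \<in> sets N"
    and num: "(\<lambda>m::nat. (\<Sum>i<m. of_bool (\<theta> i \<le> \<theta>0) * \<P>(x in sample_law \<mu> f n (\<theta> i). T x \<in> C)) / m)
      \<longlonglongrightarrow> a"
    and den: "(\<lambda>m::nat. (\<Sum>i<m. \<P>(x in sample_law \<mu> f n (\<theta> i). T x \<in> C)) / m) \<longlonglongrightarrow> b"
    and b: "b > 0"
  shows "AE x in data_law \<mu> f n UNIV \<theta>. (\<lambda>m. fdp T C \<theta>0 m \<theta> x) \<longlonglongrightarrow> a / b"
    and "(\<lambda>m. FDR \<mu> f n T C \<theta>0 m \<theta>) \<longlonglongrightarrow> a / b"
proof -
  let ?L = "\<lambda>i. sample_law \<mu> f n (\<theta> i)"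
  have L: "prob_space (?L i)" and sets_L: "sets (?L i) = sets (\<Pi>\<^sub>M j\<in>{..<n}. \<mu>)" for i
    using law[of i] by (auto simp: space_prob_algebra)
  have TL [measurable]: "T \<in> ?L i \<rightarrow>\<^sub>M N" for i
    using T by (simp add: measurable_cong_sets[OF sets_L refl])
  note C [measurable]
  interpret P: product_prob_space ?L UNIV
    by (intro product_prob_spaceI L)
  have data: "data_law \<mu> f n I \<theta> = PiM I ?L" for I
    by (simp add: data_law_def)
  have int: "(\<integral>x. of_bool (T x \<in> C) \<partial>?L i) = \<P>(x in ?L i. T x \<in> C)" for i
  proof -
    have "(\<integral>x. of_bool (T x \<in> C) \<partial>?L i) = (\<integral>x. indicator {x\<in>space (?L i). T x \<in> C} x \<partial>?L i)"
      by (intro Bochner_Integration.integral_cong) (auto simp: indicator_def)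
    also have "\<dots> = \<P>(x in ?L i. T x \<in> C)"
      by (subst Bochner_Integration.integral_indicator) (auto intro!: arg_cong[where f = "measure _"])
    finally show ?thesis .
  qed
  have "AE x in PiM UNIV ?L. (\<lambda>m::nat. (\<Sum>i<m. of_bool (T (x i) \<in> C)) / m
      - (\<Sum>i<m. \<integral>x. of_bool (T x \<in> C) \<partial>?L i) / m) \<longlonglongrightarrow> (0::real)"
    by (rule bounded_strong_law_PiM[OF L]) auto
  moreover have "AE x in PiM UNIV ?L. (\<lambda>m::nat. (\<Sum>i<m. of_bool (\<theta> i \<le> \<theta>0) * of_bool (T (x i) \<in> C)) / m
      - (\<Sum>i<m. \<integral>x. of_bool (\<theta> i \<le> \<theta>0) * of_bool (T x \<in> C) \<partial>?L i) / m) \<longlonglongrightarrow> (0::real)"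
    by (rule bounded_strong_law_PiM[OF L]) auto
  ultimately have lim: "AE x in PiM UNIV ?L. (\<lambda>m. fdp T C \<theta>0 m \<theta> x) \<longlonglongrightarrow> a / b"
  proof eventually_elim
    case (elim x)
    have "(\<lambda>m::nat. (\<Sum>i<m. of_bool (T (x i) \<in> C)) / m) \<longlonglongrightarrow> b"
      using tendsto_add[OF elim(1) den] by (simp add: int)
    moreover have "(\<lambda>m::nat. (\<Sum>i<m. of_bool (T (x i) \<in> C \<and> \<theta> i \<le> \<theta>0)) / m) \<longlonglongrightarrow> a"
      using tendsto_add[OF elim(2) num] by (simp add: int of_bool_conj mult.commute)
    ultimately show ?case
      unfolding fdp_def using b by (intro tendsto_ratio_of_averages)
  qed
  then show "AE x in data_law \<mu> f n UNIV \<theta>. (\<lambda>m. fdp T C \<theta>0 m \<theta> x) \<longlonglongrightarrow> a / b"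
    unfolding data .
  have meas: "fdp T C \<theta>0 m \<theta> \<in> borel_measurable (PiM I ?L)" if "{..<m} \<subseteq> I" for m I
  proof -
    have [measurable]: "(\<lambda>x. x i) \<in> PiM I ?L \<rightarrow>\<^sub>M ?L i" if "i < m" for i
      using that \<open>{..<m} \<subseteq> I\<close> by (intro measurable_component_singleton) auto
    have "(\<lambda>x. T (x i)) \<in> PiM I ?L \<rightarrow>\<^sub>M N" if "i < m" for i
      using that by measurable
    then have "(\<lambda>x. of_bool (T (x i) \<in> C)::real) \<in> borel_measurable (PiM I ?L)"
        "(\<lambda>x. of_bool (T (x i) \<in> C \<and> \<theta> i \<le> \<theta>0)::real) \<in> borel_measurable (PiM I ?L)"
      if "i < m" for i using that by measurable
    then show ?thesis
      unfolding fdp_def[abs_def]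
      by (intro borel_measurable_divide borel_measurable_max borel_measurable_sum) auto
  qed
  have bound: "\<bar>fdp T C \<theta>0 m \<theta> x\<bar> \<le> 1" for m x
  proof -
    have "(\<Sum>i<m. of_bool (T (x i) \<in> C \<and> \<theta> i \<le> \<theta>0) :: real) \<le> (\<Sum>i<m. of_bool (T (x i) \<in> C))"
      by (intro sum_mono) auto
    then show ?thesis
      unfolding fdp_def by (simp add: sum_nonneg)
  qed
  \<comment> \<open>Dominated convergence needs one measure for all \<open>m\<close>, whereas \<open>FDR\<close> integrates over the first
    \<open>m\<close> groups only; the law of these is the marginal of the law of all groups.\<close>
  have FDR: "FDR \<mu> f n T C \<theta>0 m \<theta> = (\<integral>x. fdp T C \<theta>0 m \<theta> x \<partial>PiM UNIV ?L)" for m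
  proof -
    have "FDR \<mu> f n T C \<theta>0 m \<theta>
        = (\<integral>x. fdp T C \<theta>0 m \<theta> x \<partial>distr (PiM UNIV ?L) (PiM {..<m} ?L) (\<lambda>x. restrict x {..<m}))"
      by (simp add: FDR_def data P.distr_PiM_restrict_finite)
    also have "\<dots> = (\<integral>x. fdp T C \<theta>0 m \<theta> (restrict x {..<m}) \<partial>PiM UNIV ?L)"
      by (intro integral_distr measurable_restrict_subset meas) auto
    finally show ?thesis by (simp add: fdp_def)
  qed
  have "(\<lambda>m. \<integral>x. fdp T C \<theta>0 m \<theta> x \<partial>PiM UNIV ?L) \<longlonglongrightarrow> (\<integral>x. a / b \<partial>PiM UNIV ?L)"
    by (rule integral_dominated_convergence[where w = "\<lambda>_. 1"]) (use lim meas bound in auto)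
  then show "(\<lambda>m. FDR \<mu> f n T C \<theta>0 m \<theta>) \<longlonglongrightarrow> a / b"
    by (simp add: FDR P.P.prob_space)
qed

section \<open>Convergence to the Bayesian false discovery rate\<close>

theorem mainTheorem1:
  fixes \<mu> :: "'a measure" and N :: "'b measure"
    and f :: "'a \<Rightarrow> real \<Rightarrow> real"
    and \<Omega> :: "real set" and \<theta>0 :: real
    and G :: "real \<Rightarrow> real"
    and n :: nat
    and T :: "(nat \<Rightarrow> 'a) \<Rightarrow> 'b" and C :: "'b set"
  assumes "sigma_finite_measure \<mu>"
    and "is_interval \<Omega>" and "\<theta>0 \<in> \<Omega>"
    and "density_family \<mu> \<Omega> f"
    and "is_cdf G" and "measure (interval_measure G) \<Omega> = 1"
    and "T \<in> measurable (\<Pi>\<^sub>M j\<in>{..<n}. \<mu>) N" and "C \<in> sets N"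
    and "\<P>(\<omega> in joint_law \<mu> f \<Omega> G n. T (snd \<omega>) \<in> C) > 0"
  shows "AE \<theta> in (\<Pi>\<^sub>M i\<in>(UNIV :: nat set). prior \<Omega> G).
    (AE x in data_law \<mu> f n UNIV \<theta>.
      (\<lambda>m. fdp T C \<theta>0 m \<theta> x) \<longlonglongrightarrow> bayes_fdr \<mu> f \<Omega> G n T C \<theta>0) \<and>
    (\<lambda>m. FDR \<mu> f n T C \<theta>0 m \<theta>) \<longlonglongrightarrow> bayes_fdr \<mu> f \<Omega> G n T C \<theta>0"
proof -
  let ?P = "prior \<Omega> G" and ?S = "\<Pi>\<^sub>M j\<in>{..<n}. \<mu>"
  define p where "p \<theta> = \<P>(x in sample_law \<mu> f n \<theta>. T x \<in> C)" for \<theta>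
  define q where "q \<theta> = of_bool (\<theta> \<le> \<theta>0) * p \<theta>" for \<theta>
  note [measurable] = assms(7,8)
  have \<Omega>: "\<Omega> \<in> sets borel"
    using assms(2) by (rule real_interval_borel_measurable)
  have sets_P: "sets ?P = sets (restrict_space borel \<Omega>)"
    unfolding prior_def by (intro sets_restrict_space_cong) simp
  have space_P: "space ?P = \<Omega>"
    by (simp add: prior_def space_restrict_space)
  have P: "prob_space ?P"
  proof (rule prob_spaceI)
    have "emeasure (interval_measure G) \<Omega> = 1"
      using assms(6) emeasure_eq_ennreal_measure[of "interval_measure G" \<Omega>]
      by (cases "emeasure (interval_measure G) \<Omega> = \<top>") (auto simp: measure_def)
    then show "emeasure ?P (space ?P) = 1"
      using \<Omega> unfolding space_P unfolding prior_def by (subst emeasure_restrict_space) auto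
  qed
  then interpret P: prob_space ?P .
  have K: "sample_law \<mu> f n \<in> ?P \<rightarrow>\<^sub>M prob_algebra ?S"
    using measurable_sample_law[OF assms(1,4)] by (simp add: measurable_cong_sets[OF sets_P refl])
  have law: "sample_law \<mu> f n \<theta> \<in> space (prob_algebra ?S)" if "\<theta> \<in> \<Omega>" for \<theta>
    using measurable_space[OF K] that by (simp add: space_P)
  have space_K: "space (sample_law \<mu> f n \<theta>) = space ?S" if "\<theta> \<in> \<Omega>" for \<theta>
    using law[OF that] by (auto simp: space_prob_algebra dest: sets_eq_imp_space_eq)
  have space_J: "space (joint_law \<mu> f \<Omega> G n) = space (?P \<Otimes>\<^sub>M ?S)"
    unfolding joint_law_def by (rule space_bind) (use P.not_empty in auto)
  have le [measurable]: "Measurable.pred ?P (\<lambda>\<theta>. \<theta> \<le> \<theta>0)"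
    unfolding measurable_cong_sets[OF sets_P refl] by (intro measurable_restrict_space1) simp
  have joint: "\<P>(\<omega> in joint_law \<mu> f \<Omega> G n. Q (fst \<omega>) \<and> T (snd \<omega>) \<in> C)
      = (\<integral>\<theta>. of_bool (Q \<theta>) * p \<theta> \<partial>?P)" if [measurable]: "Measurable.pred ?P Q" for Q
  proof -
    have "{\<omega>\<in>space (?P \<Otimes>\<^sub>M ?S). Q (fst \<omega>) \<and> T (snd \<omega>) \<in> C} \<in> sets (?P \<Otimes>\<^sub>M ?S)"
      by measurable
    from measure_joint_law[OF P K this]
    have "\<P>(\<omega> in joint_law \<mu> f \<Omega> G n. Q (fst \<omega>) \<and> T (snd \<omega>) \<in> C)
      = (\<integral>\<theta>. measure (sample_law \<mu> f n \<theta>)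
          (Pair \<theta> -` {\<omega>\<in>space (?P \<Otimes>\<^sub>M ?S). Q (fst \<omega>) \<and> T (snd \<omega>) \<in> C}) \<partial>?P)"
      by (simp add: space_J)
    also have "\<dots> = (\<integral>\<theta>. of_bool (Q \<theta>) * p \<theta> \<partial>?P)"
      by (intro Bochner_Integration.integral_cong refl)
        (auto simp: p_def space_P space_K space_pair_measure vimage_def)
    finally show ?thesis .
  qed
  have b: "\<P>(\<omega> in joint_law \<mu> f \<Omega> G n. T (snd \<omega>) \<in> C) = (\<integral>\<theta>. p \<theta> \<partial>?P)"
    using joint[of "\<lambda>_. True"] by simp
  have a: "\<P>(\<omega> in joint_law \<mu> f \<Omega> G n. fst \<omega> \<le> \<theta>0 \<and> T (snd \<omega>) \<in> C) = (\<integral>\<theta>. q \<theta> \<partial>?P)"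
    using joint[OF le] by (simp add: q_def)
  have bayes: "bayes_fdr \<mu> f \<Omega> G n T C \<theta>0 = (\<integral>\<theta>. q \<theta> \<partial>?P) / (\<integral>\<theta>. p \<theta> \<partial>?P)"
    by (simp add: bayes_fdr_def cond_prob_def a b)
  have "{x\<in>space ?S. T x \<in> C} \<in> sets ?S"
    by measurable
  then have "(\<lambda>\<theta>. measure (sample_law \<mu> f n \<theta>) {x\<in>space ?S. T x \<in> C}) \<in> borel_measurable ?P"
    by (rule measurable_compose[OF K measurable_measure_prob_algebra])
  also have "?this \<longleftrightarrow> p \<in> borel_measurable ?P"
    by (intro measurable_cong) (simp add: p_def space_P space_K)
  finally have p [measurable]: "p \<in> borel_measurable ?P" .
  have q: "q \<in> borel_measurable ?P"
    unfolding q_def by measurable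
  have p01: "p \<theta> \<in> {0..1}" if "\<theta> \<in> \<Omega>" for \<theta>
    using law[OF that] by (auto simp: p_def space_prob_algebra intro: prob_space.prob_le_1)
  have "AE \<theta> in (\<Pi>\<^sub>M i\<in>(UNIV :: nat set). ?P).
      (\<lambda>m. (\<Sum>i<m. p (\<theta> i)) / m - (\<Sum>i<m. \<integral>x. p x \<partial>?P) / real m) \<longlonglongrightarrow> 0"
    by (rule bounded_strong_law_PiM[OF P p]) (use p01 in \<open>auto simp: space_P\<close>)
  moreover have "AE \<theta> in (\<Pi>\<^sub>M i\<in>(UNIV :: nat set). ?P).
      (\<lambda>m. (\<Sum>i<m. q (\<theta> i)) / m - (\<Sum>i<m. \<integral>x. q x \<partial>?P) / real m) \<longlonglongrightarrow> 0"
    by (rule bounded_strong_law_PiM[OF P q]) (use p01 in \<open>auto simp: space_P q_def\<close>)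
  moreover have "AE \<theta> in (\<Pi>\<^sub>M i\<in>(UNIV :: nat set). ?P). \<forall>i. \<theta> i \<in> \<Omega>"
    by (rule AE_I2) (auto simp: space_PiM space_P)
  ultimately show ?thesis
  proof eventually_elim
    case (elim \<theta>)
    have const: "(\<lambda>m. (\<Sum>i<m. c) / real m) \<longlonglongrightarrow> c" for c :: real
      by (rule Lim_transform_eventually[OF tendsto_const])
        (use eventually_gt_at_top[of 0] in eventually_elim, simp)
    have "(\<lambda>m. (\<Sum>i<m. p (\<theta> i)) / m) \<longlonglongrightarrow> (\<integral>x. p x \<partial>?P)"
      using tendsto_add[OF elim(1) const[of "\<integral>x. p x \<partial>?P"]]
      by (simp only: diff_add_cancel add_0)
    moreover have "(\<lambda>m. (\<Sum>i<m. q (\<theta> i)) / m) \<longlonglongrightarrow> (\<integral>x. q x \<partial>?P)"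
      using tendsto_add[OF elim(2) const[of "\<integral>x. q x \<partial>?P"]]
      by (simp only: diff_add_cancel add_0)
    moreover have "(\<integral>x. p x \<partial>?P) > 0"
      using assms(9) by (simp add: b)
    ultimately show ?case
      unfolding bayes p_def q_def
      by (intro conjI fdr_tendsto_given_parameters[OF law assms(7,8)]) (use elim(3) in auto)
  qed
qed

end
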